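(* For all integers $r>k\geq 1$ there is $m_0$ such that for all integers $n\geq m\geq m_0$ we have $\mathrm{tc}_{r,k}(K_{n,m}) \geq \max\{r-k+1,\ r-k+\lfloor r/k\rfloor -1\}$.
   Context: For integers $r\geq k\geq 1$, an $(r,k)$-colouring of a graph $G$ is a function $\varphi:E(G)\to\binom{[r]}{k}$, assigning to each edge a set of exactly $k$ colours from $[r]=\{1,\dots,r\}$. A subgraph $H\subseteq G$ is monochromatic if there is a colour $i$ belonging to $\varphi(e)$ for every $e\in E(H)$. For an $(r,k)$-colouring $\varphi$ of $G$, $\mathrm{tc}(G,\varphi)$ is the minimum number of monochromatic trees (a single vertex counts as a tree) whose union covers $V(G)$. The tree cover number $\mathrm{tc}_{r,k}(G)$ is the minimum $m$ such that every $(r,k)$-colouring $\varphi$ of $E(G)$ satisfies $\mathrm{tc}(G,\varphi)\leq m$. $K_{n,m}$ is the complete bipartite graph with parts of sizes $n$ and $m$. *)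

theory Defs
  imports Complex_Main
begin

record 'a ugraph =
  verts :: "'a set"
  edges :: "'a set set"

definition simple_graph :: "'a ugraph \<Rightarrow> bool" where
  "simple_graph G \<longleftrightarrow> finite (verts G) \<and> (\<forall>e\<in>edges G. e \<subseteq> verts G \<and> card e = 2)"

definition subgraph :: "'a ugraph \<Rightarrow> 'a ugraph \<Rightarrow> bool" where
  "subgraph H G \<longleftrightarrow> simple_graph H \<and> verts H \<subseteq> verts G \<and> edges H \<subseteq> edges G"

definition adj :: "'a ugraph \<Rightarrow> ('a \<times> 'a) set" where
  "adj G = {(u, v). {u, v} \<in> edges G}"

definition connected_graph :: "'a ugraph \<Rightarrow> bool" where
  "connected_graph G \<longleftrightarrow> verts G \<noteq> {} \<and> (\<forall>u\<in>verts G. \<forall>v\<in>verts G. (u, v) \<in> (adj G)\<^sup>*)"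

text \<open>A cycle is given by the list of its vertices in cyclic order.\<close>

definition is_cycle :: "'a ugraph \<Rightarrow> 'a list \<Rightarrow> bool" where
  "is_cycle G c \<longleftrightarrow> 3 \<le> length c \<and> distinct c \<and> set c \<subseteq> verts G \<and>
     (\<forall>i<length c. {c ! i, c ! (Suc i mod length c)} \<in> edges G)"

definition is_tree :: "'a ugraph \<Rightarrow> bool" where
  "is_tree G \<longleftrightarrow> simple_graph G \<and> connected_graph G \<and> \<not> (\<exists>c. is_cycle G c)"

text \<open>Colourings are total functions on vertex sets; only their values on edges of the
  graph are constrained or ever used.\<close>

definition is_colouring :: "nat \<Rightarrow> nat \<Rightarrow> 'a ugraph \<Rightarrow> ('a set \<Rightarrow> nat set) \<Rightarrow> bool" where
  "is_colouring r k G \<phi> \<longleftrightarrow> (\<forall>e\<in>edges G. \<phi> e \<subseteq> {1..r} \<and> card (\<phi> e) = k)"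

definition monochromatic :: "nat \<Rightarrow> ('a set \<Rightarrow> nat set) \<Rightarrow> 'a ugraph \<Rightarrow> bool" where
  "monochromatic r \<phi> H \<longleftrightarrow> (\<exists>i\<in>{1..r}. \<forall>e\<in>edges H. i \<in> \<phi> e)"

text \<open>The trees of a cover need not be disjoint and may have different colours.\<close>

definition tree_cover :: "nat \<Rightarrow> 'a ugraph \<Rightarrow> ('a set \<Rightarrow> nat set) \<Rightarrow> 'a ugraph set \<Rightarrow> bool" where
  "tree_cover r G \<phi> \<T> \<longleftrightarrow> finite \<T> \<and>
     (\<forall>T\<in>\<T>. subgraph T G \<and> is_tree T \<and> monochromatic r \<phi> T) \<and>
     (\<Union>T\<in>\<T>. verts T) = verts G"

text \<open>Both minima below are attained for finite graphs and \<open>r \<ge> 1\<close>; see the lemmas that follow.\<close>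

definition tc :: "nat \<Rightarrow> 'a ugraph \<Rightarrow> ('a set \<Rightarrow> nat set) \<Rightarrow> nat" where
  "tc r G \<phi> = (LEAST m. \<exists>\<T>. tree_cover r G \<phi> \<T> \<and> card \<T> = m)"

definition tree_cover_number :: "nat \<Rightarrow> nat \<Rightarrow> 'a ugraph \<Rightarrow> nat" where
  "tree_cover_number r k G = (LEAST m. \<forall>\<phi>. is_colouring r k G \<phi> \<longrightarrow> tc r G \<phi> \<le> m)"

definition complete_bipartite :: "nat \<Rightarrow> nat \<Rightarrow> (nat + nat) ugraph" where
  "complete_bipartite n m =
     \<lparr> verts = Inl ` {..<n} \<union> Inr ` {..<m},
       edges = {{Inl i, Inr j} | i j. i < n \<and> j < m} \<rparr>"

lemma simple_graph_complete_bipartite: "simple_graph (complete_bipartite n m)"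
  by (auto simp: simple_graph_def complete_bipartite_def)

lemma vertex_tree_cover:
  assumes "simple_graph G" "r \<ge> 1"
  shows "tree_cover r G \<phi> ((\<lambda>v. \<lparr>verts = {v}, edges = {}\<rparr>) ` verts G)"
proof -
  have nc: "\<not> is_cycle \<lparr>verts = {v}, edges = {}\<rparr> c" for v :: 'a and c
    by (cases c) (auto simp: is_cycle_def)
  show ?thesis
    using assms nc
    by (auto simp: tree_cover_def subgraph_def is_tree_def simple_graph_def
        connected_graph_def monochromatic_def)
qed

lemma tc_attained:
  assumes "simple_graph G" "r \<ge> 1"
  shows "\<exists>\<T>. tree_cover r G \<phi> \<T> \<and> card \<T> = tc r G \<phi>"
  unfolding tc_def by (rule LeastI_ex) (use vertex_tree_cover[OF assms] in blast)

lemma tc_le_card_verts: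
  assumes "simple_graph G" "r \<ge> 1"
  shows "tc r G \<phi> \<le> card (verts G)"
proof -
  have "tc r G \<phi> \<le> card ((\<lambda>v. \<lparr>verts = {v}, edges = {}\<rparr>) ` verts G)"
    unfolding tc_def by (rule Least_le) (use vertex_tree_cover[OF assms] in blast)
  also have "\<dots> \<le> card (verts G)"
    using assms by (intro card_image_le) (simp add: simple_graph_def)
  finally show ?thesis .
qed

lemma tc_le_tree_cover_number:
  assumes "simple_graph G" "r \<ge> 1" "is_colouring r k G \<phi>"
  shows "tc r G \<phi> \<le> tree_cover_number r k G"
proof -
  have "\<forall>\<phi>. is_colouring r k G \<phi> \<longrightarrow> tc r G \<phi> \<le> tree_cover_number r k G"
    unfolding tree_cover_number_def
    by (rule LeastI[where k = "card (verts G)"]) (use tc_le_card_verts[OF assms(1,2)] in blast)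
  with assms(3) show ?thesis by blast
qed

end

theory Submission
  imports Defs "HOL-Library.FuncSet" "HOL-Library.Disjoint_Sets"
begin

text \<open>
  Put \<open>p = max 1 (\<lfloor>r/k\<rfloor> - 1)\<close>. Split one side of the bipartite graph into \<open>p\<close> classes, and let the
  vertices of the other side range over all \<open>p\<close>-tuples of pairwise disjoint \<open>k\<close>-sets of colours,
  the \<open>i\<close>-th set of the tuple being put on the edges to the \<open>i\<close>-th class. By disjointness, a
  monochromatic tree of colour \<open>c\<close> meets only one class \<open>i\<close>, and all its vertices on the other side
  have \<open>c\<close> in their \<open>i\<close>-th set. A cover thus yields sets \<open>C\<^sub>i\<close> of colours used at class \<open>i\<close>, which are
  nonempty and such that no tuple has its \<open>i\<close>-th set disjoint from \<open>C\<^sub>i\<close> for all \<open>i\<close>. A greedy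
  argument shows that such a tuple exists as soon as \<open>\<Sum>\<^sub>i (\<bar>C\<^sub>i\<bar> - 1) < r - k\<close>, so the cover has at
  least \<open>r - k + p\<close> trees.
\<close>

section \<open>Disjoint \<open>k\<close>-sets avoiding prescribed sets\<close>

lemma disjoint_subsets_extend:
  assumes "i \<in> I" "S \<subseteq> X - C i" "card S = k"
    and "\<forall>j\<in>I - {i}. R j \<subseteq> (X - S) - C j \<and> card (R j) = k"
    and "disjoint_family_on R (I - {i})"
  shows "\<exists>R. (\<forall>j\<in>I. R j \<subseteq> X - C j \<and> card (R j) = k) \<and> disjoint_family_on R I"
proof (intro exI conjI)
  show "\<forall>j\<in>I. (R(i := S)) j \<subseteq> X - C j \<and> card ((R(i := S)) j) = k"
    using assms by auto
  show "disjoint_family_on (R(i := S)) I"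
    using assms(4,5) unfolding disjoint_family_on_def by auto
qed

text \<open>Each choice removes only \<open>k\<close> elements from what the other indices can use,
  so the bound survives with one index fewer.\<close>

lemma ex_disjoint_subsets_greedy:
  assumes "finite I" "finite X" "\<forall>i\<in>I. k * card I \<le> card (X - C i)"
  shows "\<exists>S. (\<forall>i\<in>I. S i \<subseteq> X - C i \<and> card (S i) = k) \<and> disjoint_family_on S I"
  using assms
proof (induction I arbitrary: X rule: finite_induct)
  case empty
  then show ?case by (simp add: disjoint_family_on_def)
next
  case (insert i I)
  have "k \<le> card (X - C i)" using insert.prems insert.hyps by simp
  then obtain S where S: "S \<subseteq> X - C i" "card S = k" "finite S"
    by (meson obtain_subset_with_card_n)
  have "k * card I \<le> card ((X - S) - C j)" if "j \<in> I" for j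
  proof -
    have "k + k * card I \<le> card (X - C j)" using insert.prems insert.hyps that by simp
    moreover have "card (X - C j) - card S \<le> card ((X - C j) - S)"
      using S(3) by (rule diff_card_le_card_Diff)
    moreover have "(X - C j) - S = (X - S) - C j" by auto
    ultimately show ?thesis using S by simp
  qed
  with insert.IH[of "X - S"] insert.prems obtain R where
    "\<forall>j\<in>I. R j \<subseteq> (X - S) - C j \<and> card (R j) = k" "disjoint_family_on R I"
    by auto
  then show ?case
    using disjoint_subsets_extend[of i "insert i I" S X C k R] S insert.hyps by simp
qed

text \<open>Serving an index with \<open>card (C i) > k\<close> first uses up \<open>k\<close>
  elements of \<open>X\<close>, but drops a summand of at least \<open>k\<close> from the sum. Once
  no such index is left, every \<open>X - C i\<close> is large enough for the greedy choice.\<close>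

lemma ex_disjoint_subsets:
  assumes "finite I" "finite X" "\<forall>i\<in>I. finite (C i)"
    and "card I \<le> 1 \<or> k * (card I + 1) \<le> card X"
    and "I \<noteq> {} \<Longrightarrow> (\<Sum>i\<in>I. card (C i) - 1) + k < card X"
  shows "\<exists>S. (\<forall>i\<in>I. S i \<subseteq> X - C i \<and> card (S i) = k) \<and> disjoint_family_on S I"
  using assms
proof (induction "card I" arbitrary: I X rule: less_induct)
  case (less I)
  have avail: "card X - card (C i) \<le> card (X - C i)" if "i \<in> I" for i
    using less.prems that by (intro diff_card_le_card_Diff) auto
  show ?case
  proof (cases "\<exists>i\<in>I. card (C i) > k")
    case True
    then obtain i where i: "i \<in> I" "card (C i) > k" by blast
    let ?J = "I - {i}"
    have sum: "(\<Sum>i\<in>I. card (C i) - 1) = (card (C i) - 1) + (\<Sum>i\<in>?J. card (C i) - 1)"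
      using less.prems i by (simp add: sum.remove)
    have bound: "(card (C i) - 1) + (\<Sum>i\<in>?J. card (C i) - 1) + k < card X"
      using less.prems(5) i unfolding sum by blast
    have "k \<le> card (X - C i)" using avail[OF i(1)] bound by linarith
    then obtain S where S: "S \<subseteq> X - C i" "card S = k" "finite S"
      by (meson obtain_subset_with_card_n)
    have cX: "card (X - S) = card X - k" using S by (subst card_Diff_subset) auto
    have cI: "card I = Suc (card ?J)"
      using i less.prems by (metis card.remove)
    have "\<exists>R. (\<forall>j\<in>?J. R j \<subseteq> (X - S) - C j \<and> card (R j) = k) \<and> disjoint_family_on R ?J"
    proof (rule less.hyps)
      show "card ?J < card I" using cI by simp
      show "finite ?J" "finite (X - S)" "\<forall>i\<in>?J. finite (C i)" using less.prems by auto
      show "card ?J \<le> 1 \<or> k * (card ?J + 1) \<le> card (X - S)"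
        using less.prems(4) cX cI by auto
      show "(\<Sum>i\<in>?J. card (C i) - 1) + k < card (X - S)"
        using bound i(2) cX by linarith
    qed
    then show ?thesis using disjoint_subsets_extend[of i I S X C k] i(1) S by blast
  next
    case False
    \<comment> \<open>With two or more indices, \<open>card (C i) \<le> k\<close> and
      \<open>k * (card I + 1) \<le> card X\<close> give this; a single index relies on the sum bound
      instead.\<close>
    have "k * card I \<le> card (X - C i)" if i: "i \<in> I" for i
    proof (cases "card I \<le> 1")
      case True
      then have "I = {i}" using i less.prems(1) by (auto simp: card_le_Suc0_iff_eq)
      then have "card (C i) - 1 + k < card X" using less.prems(5) by simp
      then show ?thesis using \<open>I = {i}\<close> avail[OF i] by simp
    next
      case False
      then have "k * card I + k \<le> card X" using less.prems(4) by simp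
      moreover have "card (C i) \<le> k" using \<open>\<not> (\<exists>i\<in>I. card (C i) > k)\<close> i by auto
      ultimately show ?thesis using avail[OF i] by linarith
    qed
    then show ?thesis using less.prems by (intro ex_disjoint_subsets_greedy) auto
  qed
qed

section \<open>Monochromatic components of the tuple colouring\<close>

text \<open>
  The vertex \<open>Inl a\<close> belongs to the class \<open>a mod p\<close>, and \<open>f b i\<close> is the \<open>i\<close>-th set of the tuple at
  \<open>Inr b\<close>.
\<close>

definition tuple_colouring :: "nat \<Rightarrow> (nat \<Rightarrow> nat \<Rightarrow> nat set) \<Rightarrow> (nat + nat) set \<Rightarrow> nat set" where
  "tuple_colouring p f e = \<Union>{f b (a mod p) | a b. e = {Inl a, Inr b}}"

lemma tuple_colouring_edge [simp]: "tuple_colouring p f {Inl a, Inr b} = f b (a mod p)"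
  by (auto simp: tuple_colouring_def doubleton_eq_iff)

text \<open>For disjoint tuples and \<open>i < p\<close>, no edge of colour \<open>c\<close> leaves
  this vertex set, as \<open>c\<close> lies in no other set of a tuple that has it at
  \<open>i\<close>.\<close>

definition in_component :: "nat \<Rightarrow> (nat \<Rightarrow> nat \<Rightarrow> nat set) \<Rightarrow> nat \<Rightarrow> nat \<Rightarrow> nat + nat \<Rightarrow> bool" where
  "in_component p f i c v = (case v of Inl a \<Rightarrow> a mod p = i | Inr b \<Rightarrow> c \<in> f b i)"

text \<open>A vertex \<open>Inl a\<close> of the tree fixes the class, and connectedness spreads
  membership to all of \<open>T\<close>. Without such a vertex, \<open>T\<close> has just one
  vertex.\<close>

lemma monochromatic_tree_in_component:
  assumes p: "p > 0" and T: "subgraph T (complete_bipartite n m)" "connected_graph T"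
    and mono: "monochromatic r (tuple_colouring p f) T"
    and disj: "\<And>b. disjoint_family_on (f b) {..<p}" and ne: "\<And>b i. i < p \<Longrightarrow> f b i \<noteq> {}"
  shows "\<exists>i c. i < p \<and> (\<forall>v\<in>verts T. in_component p f i c v)"
proof -
  obtain c where c: "\<And>e. e \<in> edges T \<Longrightarrow> c \<in> tuple_colouring p f e"
    using mono by (auto simp: monochromatic_def)
  have edge: "\<exists>a b. c \<in> f b (a mod p) \<and> (u = Inl a \<and> v = Inr b \<or> u = Inr b \<and> v = Inl a)
      \<and> v \<in> verts T" if "(u, v) \<in> adj T" for u v
  proof -
    have e: "{u, v} \<in> edges T" using that by (simp add: adj_def)
    then have "{u, v} \<in> edges (complete_bipartite n m)" using T(1) by (auto simp: subgraph_def)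
    then obtain a b where ab: "{u, v} = {Inl a, Inr b}" by (auto simp: complete_bipartite_def)
    have "c \<in> f b (a mod p)" using c[OF e] unfolding ab by simp
    moreover have "v \<in> verts T" using e T(1) by (auto simp: subgraph_def simple_graph_def)
    ultimately show ?thesis using ab by (auto simp: doubleton_eq_iff)
  qed
  have step: "in_component p f i c v"
    if "in_component p f i c u" "(u, v) \<in> adj T" "i < p" for i u v
  proof -
    note uv_adj = that(2)
    obtain a b where c: "c \<in> f b (a mod p)"
      and uv: "u = Inl a \<and> v = Inr b \<or> u = Inr b \<and> v = Inl a"
      using edge[OF uv_adj] by blast
    from uv show ?thesis
    proof
      assume "u = Inl a \<and> v = Inr b"
      then show ?thesis using that c by (auto simp: in_component_def)
    next
      assume u: "u = Inr b \<and> v = Inl a"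
      then have "c \<in> f b i" using that by (simp add: in_component_def)
      then have "a mod p = i"
        using c disj[of b] p that(3) by (fastforce simp: disjoint_family_on_def)
      then show ?thesis using u by (simp add: in_component_def)
    qed
  qed
  have reach: "in_component p f i c v"
    if "(u, v) \<in> (adj T)\<^sup>*" "in_component p f i c u" "i < p" for i u v
    using that by (induction rule: rtrancl_induct) (auto intro: step)
  show ?thesis
  proof (cases "\<exists>a. Inl a \<in> verts T")
    case True
    then obtain a where a: "Inl a \<in> verts T" by blast
    have "in_component p f (a mod p) c v" if "v \<in> verts T" for v
      using T(2) a that p by (intro reach[of "Inl a" v]) (auto simp: connected_graph_def in_component_def)
    then show ?thesis using p by (meson mod_less_divisor)
  next
    case False
    obtain u where u: "u \<in> verts T" using T(2) by (auto simp: connected_graph_def)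
    with False obtain b where b: "u = Inr b" by (cases u) auto
    have "v = Inr b" if "v \<in> verts T" for v
    proof -
      have "(u, v) \<in> (adj T)\<^sup>*" using T(2) u that by (auto simp: connected_graph_def)
      then show ?thesis unfolding b
      proof (cases rule: converse_rtranclE)
        case (step w)
        then show ?thesis using edge[OF step(1)] False by auto
      qed auto
    qed
    \<comment> \<open>A single vertex has no edge to fix its colour, so \<open>c\<close> may be
      replaced by any element of its set for class 0.\<close>
    moreover obtain d where "d \<in> f b 0" using ne[OF p] by blast
    ultimately have "\<forall>v\<in>verts T. in_component p f 0 d v"
      by (fastforce simp: in_component_def)
    then show ?thesis using p by blast
  qed
qed

section \<open>Counting the trees of a cover\<close>

definition disjoint_tuples :: "nat \<Rightarrow> nat \<Rightarrow> nat \<Rightarrow> (nat \<Rightarrow> nat set) set" where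
  "disjoint_tuples p r k = {S \<in> {..<p} \<rightarrow>\<^sub>E Pow {1..r}.
     (\<forall>i<p. card (S i) = k) \<and> disjoint_family_on S {..<p}}"

lemma finite_disjoint_tuples: "finite (disjoint_tuples p r k)"
proof (rule finite_subset)
  show "disjoint_tuples p r k \<subseteq> {..<p} \<rightarrow>\<^sub>E Pow {1..r}" by (auto simp: disjoint_tuples_def)
qed (intro finite_PiE; simp)

lemma ex_disjoint_tuple_avoiding:
  assumes "p > 0" "p = 1 \<or> k * (p + 1) \<le> r"
    and "\<forall>i<p. finite (C i)" "(\<Sum>i<p. card (C i) - 1) + k < r"
  shows "\<exists>S\<in>disjoint_tuples p r k. \<forall>i<p. S i \<inter> C i = {}"
proof -
  have "\<exists>S. (\<forall>i\<in>{..<p}. S i \<subseteq> {1..r} - C i \<and> card (S i) = k) \<and> disjoint_family_on S {..<p}"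
    using assms by (intro ex_disjoint_subsets) auto
  then obtain S where S: "\<forall>i\<in>{..<p}. S i \<subseteq> {1..r} - C i \<and> card (S i) = k"
    "disjoint_family_on S {..<p}" by blast
  \<comment> \<open>Tuples are extensional, which keeps their number finite.\<close>
  have "restrict S {..<p} \<in> disjoint_tuples p r k"
    using S by (auto simp: disjoint_tuples_def disjoint_family_on_def)
  then show ?thesis using S by (intro bexI[of _ "restrict S {..<p}"]) auto
qed

lemma tree_cover_ge:
  assumes p: "p > 0" "p = 1 \<or> k * (p + 1) \<le> r" and k: "1 \<le> k" "k < r"
    and f: "range f \<subseteq> disjoint_tuples p r k" "disjoint_tuples p r k \<subseteq> f ` {..<m}" and n: "p \<le> n"
    and cov: "tree_cover r (complete_bipartite n m) (tuple_colouring p f) \<T>"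
  shows "r - k + p \<le> card \<T>"
proof (rule ccontr)
  assume small: "\<not> r - k + p \<le> card \<T>"
  let ?G = "complete_bipartite n m"
  have fin: "finite \<T>" and vts: "(\<Union>T\<in>\<T>. verts T) = verts ?G"
    and trees: "\<And>T. T \<in> \<T> \<Longrightarrow> subgraph T ?G \<and> is_tree T \<and> monochromatic r (tuple_colouring p f) T"
    using cov by (auto simp: tree_cover_def)
  have fb: "f b \<in> disjoint_tuples p r k" for b using f(1) by blast
  have "\<exists>q. fst q < p \<and> (\<forall>v\<in>verts T. in_component p f (fst q) (snd q) v)" if "T \<in> \<T>" for T
  proof -
    have "\<exists>i c. i < p \<and> (\<forall>v\<in>verts T. in_component p f i c v)"
    proof (rule monochromatic_tree_in_component[OF p(1)])
      show "subgraph T ?G" "connected_graph T" "monochromatic r (tuple_colouring p f) T"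
        using trees[OF that] by (auto simp: is_tree_def)
      show "disjoint_family_on (f b) {..<p}" for b
        using fb[of b] by (simp add: disjoint_tuples_def)
      show "f b i \<noteq> {}" if "i < p" for b i
        using fb[of b] that k by (auto simp: disjoint_tuples_def)
    qed
    then show ?thesis by auto
  qed
  then obtain q where q: "\<And>T. T \<in> \<T> \<Longrightarrow> fst (q T) < p"
    "\<And>T v. T \<in> \<T> \<Longrightarrow> v \<in> verts T \<Longrightarrow> in_component p f (fst (q T)) (snd (q T)) v"
    by metis
  define C where "C i = {c. (i, c) \<in> q ` \<T>}" for i
  have finC: "finite (C i)" for i
  proof (rule finite_subset)
    show "C i \<subseteq> snd ` q ` \<T>" unfolding C_def by (auto simp: image_image) (metis image_eqI snd_conv)
  qed (use fin in simp)
  have neC: "C i \<noteq> {}" if "i < p" for i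
  proof -
    \<comment> \<open>The vertex \<open>Inl i\<close> represents class \<open>i\<close>, and exists
      because \<open>p \<le> n\<close>.\<close>
    have "Inl i \<in> verts ?G" using that n by (simp add: complete_bipartite_def)
    then obtain T where T: "T \<in> \<T>" "Inl i \<in> verts T" using vts by blast
    then have "fst (q T) = i" using q(2)[OF T] that by (simp add: in_component_def)
    then have "snd (q T) \<in> C i" using T(1) unfolding C_def by force
    then show ?thesis by blast
  qed
  have "(\<Sum>i<p. card (C i)) = card (SIGMA i:{..<p}. C i)" using finC by simp
  also have "\<dots> \<le> card (q ` \<T>)" using fin by (intro card_mono) (auto simp: C_def)
  also have "\<dots> \<le> card \<T>" using fin by (rule card_image_le)
  finally have "(\<Sum>i<p. card (C i)) \<le> card \<T>" .
  \<comment> \<open>Nonemptiness makes the truncated subtraction exact, so the \<open>p\<close>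
    classes contribute the summand \<open>p\<close> of the bound.\<close>
  moreover have "(\<Sum>i<p. card (C i)) = (\<Sum>i<p. (card (C i) - 1) + 1)"
    using neC finC by (intro sum.cong) (auto simp: Suc_le_eq card_gt_0_iff)
  then have "(\<Sum>i<p. card (C i)) = (\<Sum>i<p. card (C i) - 1) + p"
    by (simp only: sum.distrib) simp
  ultimately have "(\<Sum>i<p. card (C i) - 1) + k < r" using small k by linarith
  then obtain S where S: "S \<in> disjoint_tuples p r k" "\<forall>i<p. S i \<inter> C i = {}"
    using ex_disjoint_tuple_avoiding[OF p] finC by blast
  \<comment> \<open>Every tuple occurs at some vertex, so the tree covering that vertex has its
    colour both in \<open>S\<close> and in \<open>C\<close> at its class.\<close>
  obtain b where b: "b < m" "S = f b" using S(1) f(2) by auto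
  have "Inr b \<in> verts ?G" using b by (simp add: complete_bipartite_def)
  then obtain T where T: "T \<in> \<T>" "Inr b \<in> verts T" using vts by blast
  have "snd (q T) \<in> S (fst (q T))" using q(2)[OF T] b by (simp add: in_component_def)
  moreover have "snd (q T) \<in> C (fst (q T))" using T(1) by (simp add: C_def)
  ultimately show False using S(2) q(1)[OF T(1)] by blast
qed

lemma tree_cover_number_complete_bipartite_ge:
  assumes p: "p > 0" "p = 1 \<or> k * (p + 1) \<le> r" and k: "1 \<le> k" "k < r"
    and n: "p \<le> n" and m: "card (disjoint_tuples p r k) \<le> m"
  shows "r - k + p \<le> tree_cover_number r k (complete_bipartite n m)"
proof -
  let ?D = "disjoint_tuples p r k" and ?G = "complete_bipartite n m"
  let ?N = "card ?D"
  obtain g where g: "bij_betw g {0..<?N} ?D"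
    using ex_bij_betw_nat_finite[OF finite_disjoint_tuples] by blast
  have "?D \<noteq> {}" using ex_disjoint_tuple_avoiding[OF p, of "\<lambda>_. {}"] k by auto
  then have N: "?N > 0" using finite_disjoint_tuples by (simp add: card_gt_0_iff)
  \<comment> \<open>Reduction modulo \<open>?N\<close> gives the vertices beyond the first
    \<open>?N\<close> a tuple as well.\<close>
  define f where "f j = g (j mod ?N)" for j
  have f1: "range f \<subseteq> ?D" using g N by (auto simp: f_def bij_betw_def)
  have f2: "?D \<subseteq> f ` {..<m}"
  proof
    fix S assume "S \<in> ?D"
    then have "S \<in> g ` {0..<?N}" using g by (simp add: bij_betw_def)
    then obtain j where "j < ?N" "S = g j" by auto
    then show "S \<in> f ` {..<m}" using m by (intro image_eqI[of _ _ j]) (auto simp: f_def)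
  qed
  have "is_colouring r k ?G (tuple_colouring p f)"
    unfolding is_colouring_def
  proof
    fix e assume "e \<in> edges ?G"
    then obtain a b where e: "e = {Inl a, Inr b}" by (auto simp: complete_bipartite_def)
    have "f b \<in> ?D" using f1 by blast
    moreover have "a mod p < p" using p by simp
    ultimately show "tuple_colouring p f e \<subseteq> {1..r} \<and> card (tuple_colouring p f e) = k"
      unfolding e tuple_colouring_edge disjoint_tuples_def by blast
  qed
  then have "tc r ?G (tuple_colouring p f) \<le> tree_cover_number r k ?G"
    using k by (intro tc_le_tree_cover_number simple_graph_complete_bipartite) auto
  moreover obtain \<T> where "tree_cover r ?G (tuple_colouring p f) \<T>"
    "card \<T> = tc r ?G (tuple_colouring p f)"
    using tc_attained[OF simple_graph_complete_bipartite, of r] k by (metis less_imp_le_nat order_trans)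
  moreover from this have "r - k + p \<le> card \<T>"
    using tree_cover_ge[OF p k f1 f2 n] by blast
  ultimately show ?thesis by simp
qed

theorem theorem1p6:
  fixes r k :: nat
  assumes "1 \<le> k" and "k < r"
  shows "\<exists>m\<^sub>0. \<forall>n m. n \<ge> m \<and> m \<ge> m\<^sub>0 \<longrightarrow>
    int (tree_cover_number r k (complete_bipartite n m))
      \<ge> max (int r - int k + 1) (int r - int k + \<lfloor>real r / real k\<rfloor> - 1)"
proof -
  \<comment> \<open>If \<open>r div k \<ge> 2\<close>, this is the largest \<open>p\<close> with
    \<open>k * (p + 1) \<le> r\<close>; the value 1 yields the first term of the maximum.\<close>
  define p where "p = max 1 (r div k - 1)"
  have p: "p > 0" by (simp add: p_def)
  have p': "p = 1 \<or> k * (p + 1) \<le> r"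
  proof (cases "p = 1")
    case False
    then have "p + 1 = r div k" by (auto simp: p_def)
    then show ?thesis by simp
  qed simp
  have fl: "\<lfloor>real r / real k\<rfloor> = int (r div k)" by (simp add: floor_divide_of_nat_eq)
  show ?thesis
  proof (intro exI allI impI)
    \<comment> \<open>One side needs room for all tuples, the other for a vertex in each
      class.\<close>
    fix n m assume nm: "n \<ge> m \<and> m \<ge> max p (card (disjoint_tuples p r k))"
    then have "r - k + p \<le> tree_cover_number r k (complete_bipartite n m)"
      using tree_cover_number_complete_bipartite_ge[OF p p' assms, of n m] by simp
    then show "int (tree_cover_number r k (complete_bipartite n m))
      \<ge> max (int r - int k + 1) (int r - int k + \<lfloor>real r / real k\<rfloor> - 1)"
      using assms(2) unfolding fl p_def by linarith
  qed
qed

end
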